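(* For a chordal building set $\mathcal{B}$ on $[n]$, the $h$-polynomial of the extended nestohedron $\mathcal{P}^{\square}(\mathcal{B})$ is $$h_{\mathcal{P}^{\square}(\mathcal{B})}(t)=\sum_{w\in\mathfrak{S}^{\square}_{n+1}(\mathcal{B})}t^{\operatorname{des}(w)}.$$
   Context: A building set on $[n]$ is a collection $\mathcal{B}$ of nonempty subsets of $[n]$ containing all singletons and such that $I\cup J\in\mathcal{B}$ whenever $I,J\in\mathcal{B}$, $I\cap J\neq\varnothing$. It is chordal if for every $I=\{i_1<\dots<i_r\}\in\mathcal{B}$ and every $s\in[r]$, $\{i_s,i_{s+1},\dots,i_r\}\in\mathcal{B}$. For $Y\subseteq[n]$, $\mathcal{B}|_Y=\{J\in\mathcal{B}:J\subseteq Y\}$; two elements $a,b\in Y$ lie in the same connected component of $\mathcal{B}|_Y$ if some $J\in\mathcal{B}$ with $J\subseteq Y$ contains both. A partial permutation of $[n]$ is a word $w=(a_1,\dots,a_k)$ of distinct elements of $[n]$ ($0\le k\le n$). It is a $\mathcal{B}$-partial permutation if for every $i\in[k]$, $a_i$ and $\max\{a_1,\dots,a_i\}$ lie in the same connected component of $\mathcal{B}|_{\{a_1,\dots,a_i\}}$. Let $\varphi_n(w)\in\mathfrak{S}_{n+1}$ be the permutation (in one-line notation) obtained by appending the elements of $[n+1]\setminus\{a_1,\dots,a_k\}$ to $w$ in decreasing order, and let $\mathfrak{S}^{\square}_{n+1}(\mathcal{B})$ be the set of $\varphi_n(w)$ over all $\mathcal{B}$-partial permutations $w$. For $u\in\mathfrak{S}_{n+1}$,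 $\operatorname{des}(u)=|\{i\in[n]:u(i)>u(i+1)\}|$. An extended nested collection of $\mathcal{B}$ is a set $\{I_1,\dots,I_m,x_{i_1},\dots,x_{i_r}\}$ with $I_j\in\mathcal{B}$ and formal symbols $x_i$ ($i\in[n]$) such that the $I_j$ are pairwise nested or disjoint, no union of $k\ge2$ pairwise disjoint $I_j$'s lies in $\mathcal{B}$, and no $i_\ell$ lies in any $I_j$. The extended nestohedron $\mathcal{P}^{\square}(\mathcal{B})$ is an $n$-dimensional simple polytope whose number $f_i$ of $i$-faces equals the number of extended nested collections of cardinality $n-i$; its $h$-polynomial is defined by $\sum_{i=0}^n f_it^i=h(t+1)$. *)

theory Defs
  imports
    "HOL-Analysis.Polytope"
    "HOL-Computational_Algebra.Polynomial"
    "HOL-Combinatorics.Permutations"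
begin

definition building_set :: "nat \<Rightarrow> nat set set \<Rightarrow> bool" where
  "building_set n B \<longleftrightarrow>
     (\<forall>I\<in>B. I \<noteq> {} \<and> I \<subseteq> {1..n}) \<and>
     (\<forall>i\<in>{1..n}. {i} \<in> B) \<and>
     (\<forall>I\<in>B. \<forall>J\<in>B. I \<inter> J \<noteq> {} \<longrightarrow> I \<union> J \<in> B)"

definition chordal :: "nat set set \<Rightarrow> bool" where
  "chordal B \<longleftrightarrow> (\<forall>I\<in>B. \<forall>i\<in>I. {j \<in> I. i \<le> j} \<in> B)"

definition restriction :: "nat set set \<Rightarrow> nat set \<Rightarrow> nat set set" where
  "restriction B Y = {J \<in> B. J \<subseteq> Y}"

definition same_component :: "nat set set \<Rightarrow> nat set \<Rightarrow> nat \<Rightarrow> nat \<Rightarrow> bool" where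
  "same_component B Y a b \<longleftrightarrow> (\<exists>J\<in>restriction B Y. a \<in> J \<and> b \<in> J)"

definition partial_permutation :: "nat \<Rightarrow> nat list \<Rightarrow> bool" where
  "partial_permutation n w \<longleftrightarrow> distinct w \<and> set w \<subseteq> {1..n}"

definition B_partial_permutation :: "nat \<Rightarrow> nat set set \<Rightarrow> nat list \<Rightarrow> bool" where
  "B_partial_permutation n B w \<longleftrightarrow>
     partial_permutation n w \<and>
     (\<forall>i\<in>{1..length w}.
        same_component B (set (take i w)) (w ! (i - 1)) (Max (set (take i w))))"

text \<open>Permutations are functions on the naturals fixing everything outside \<open>{1..length xs}\<close>,
  as in the library's \<open>permutes\<close>; one-line notation is indexed from 1.\<close>

definition one_line :: "nat list \<Rightarrow> nat \<Rightarrow> nat" where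
  "one_line xs i = (if i \<in> {1..length xs} then xs ! (i - 1) else i)"

definition perm_completion :: "nat \<Rightarrow> nat list \<Rightarrow> nat \<Rightarrow> nat" where
  "perm_completion n w = one_line (w @ rev (sorted_list_of_set ({1..n + 1} - set w)))"

definition extended_B_permutations :: "nat \<Rightarrow> nat set set \<Rightarrow> (nat \<Rightarrow> nat) set" where
  "extended_B_permutations n B = perm_completion n ` {w. B_partial_permutation n B w}"

text \<open>Number of descents of a permutation of \<open>{1..n + 1}\<close>.\<close>

definition des :: "nat \<Rightarrow> (nat \<Rightarrow> nat) \<Rightarrow> nat" where
  "des n u = card {i \<in> {1..n}. u i > u (i + 1)}"

lemma one_line_permutes:
  assumes "distinct xs" "set xs = {1..length xs}"
  shows "one_line xs permutes {1..length xs}"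
proof (rule bij_imp_permutes)
  have "bij_betw (\<lambda>i. xs ! (i - 1)) {1..length xs} (set xs)"
    unfolding bij_betw_def
  proof
    show "inj_on (\<lambda>i. xs ! (i - 1)) {1..length xs}"
      using assms(1) by (auto simp: inj_on_def nth_eq_iff_index_eq)
    show "(\<lambda>i. xs ! (i - 1)) ` {1..length xs} = set xs"
    proof (intro equalityI subsetI)
      fix x assume "x \<in> set xs"
      then obtain k where "k < length xs" "x = xs ! k"
        by (auto simp: in_set_conv_nth)
      then show "x \<in> (\<lambda>i. xs ! (i - 1)) ` {1..length xs}"
        by (intro image_eqI[of _ _ "Suc k"]) auto
    qed auto
  qed
  then have "bij_betw (\<lambda>i. xs ! (i - 1)) {1..length xs} {1..length xs}"
    unfolding assms(2) .
  then show "bij_betw (one_line xs) {1..length xs} {1..length xs}"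
    by (subst bij_betw_cong[where g = "\<lambda>i. xs ! (i - 1)"]) (simp add: one_line_def)
qed (auto simp: one_line_def)

lemma perm_completion_permutes:
  assumes "partial_permutation n w"
  shows "perm_completion n w permutes {1..n + 1}"
proof -
  let ?xs = "w @ rev (sorted_list_of_set ({1..n + 1} - set w))"
  have d: "distinct ?xs" and s: "set ?xs = {1..n + 1}"
    using assms by (auto simp: partial_permutation_def)
  have "length ?xs = n + 1"
    using distinct_card[OF d] unfolding s by simp
  then show ?thesis
    using one_line_permutes[OF d] s by (simp add: perm_completion_def)
qed

text \<open>\<open>Design i\<close> is the formal symbol \<open>x\<^sub>i\<close>.\<close>

datatype ext_element = Tube "nat set" | Design nat

definition extended_nested_collection :: "nat \<Rightarrow> nat set set \<Rightarrow> ext_element set \<Rightarrow> bool" where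
  "extended_nested_collection n B N \<longleftrightarrow>
     N \<subseteq> Tube ` B \<union> Design ` {1..n} \<and>
     (\<forall>I J. Tube I \<in> N \<longrightarrow> Tube J \<in> N \<longrightarrow> I \<subseteq> J \<or> J \<subseteq> I \<or> I \<inter> J = {}) \<and>
     (\<forall>S. S \<subseteq> {I. Tube I \<in> N} \<longrightarrow> 2 \<le> card S \<longrightarrow> pairwise disjnt S \<longrightarrow> \<Union>S \<notin> B) \<and>
     (\<forall>i I. Design i \<in> N \<longrightarrow> Tube I \<in> N \<longrightarrow> i \<notin> I)"

text \<open>The extended nestohedron is determined up to combinatorial equivalence: its nonempty faces,
  ordered by reverse inclusion, form the complex of extended nested collections. In particular it
  is simple, and its \<open>i\<close>-faces correspond to the collections of cardinality \<open>n - i\<close>.\<close>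

definition extended_nestohedron :: "nat \<Rightarrow> nat set set \<Rightarrow> 'a::euclidean_space set \<Rightarrow> bool" where
  "extended_nestohedron n B P \<longleftrightarrow>
     polytope P \<and> aff_dim P = int n \<and>
     (\<exists>\<Phi>. bij_betw \<Phi> {N. extended_nested_collection n B N} {F. F face_of P \<and> F \<noteq> {}} \<and>
          (\<forall>M N. extended_nested_collection n B M \<longrightarrow> extended_nested_collection n B N \<longrightarrow>
             (\<Phi> N \<subseteq> \<Phi> M \<longleftrightarrow> M \<subseteq> N)))"

definition face_number :: "'a::euclidean_space set \<Rightarrow> nat \<Rightarrow> nat" where
  "face_number P i = card {F. F face_of P \<and> aff_dim F = int i}"

definition f_polynomial :: "'a::euclidean_space set \<Rightarrow> int poly" where
  "f_polynomial P = (\<Sum>i\<le>nat (aff_dim P). monom (int (face_number P i)) i)"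

text \<open>The defining relation \<open>f(t) = h(t + 1)\<close>.\<close>

definition h_polynomial :: "'a::euclidean_space set \<Rightarrow> int poly" where
  "h_polynomial P = (THE h. f_polynomial P = pcompose h [:1, 1:])"

lemma h_polynomial_unique:
  "\<exists>!h. f_polynomial P = pcompose h [:1, 1:]"
proof
  show "f_polynomial P = pcompose (pcompose (f_polynomial P) [:-1, 1:]) [:1, 1:]"
    by (simp flip: pcompose_assoc add: pcompose_pCons)
next
  fix h assume "f_polynomial P = pcompose h [:1, 1:]"
  then show "h = pcompose (f_polynomial P) [:-1, 1:]"
    by (simp flip: pcompose_assoc add: pcompose_pCons)
qed

lemma pcompose_h_polynomial: "pcompose (h_polynomial P) [:1, 1:] = f_polynomial P"
  unfolding h_polynomial_def using theI'[OF h_polynomial_unique[of P]] by simp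

end

theory Submission
  imports Defs
begin

text \<open>
  Let \<open>K(Z)\<close> be the connected component of \<open>max Z\<close> in the restriction of \<open>B\<close> to \<open>Z\<close>. Removing
  \<open>K(Z)\<close>, which is always a member, from a nested collection whose tubes have union \<open>Z\<close> leaves an
  arbitrary nested collection with union \<open>Z - C\<close> for a nonempty \<open>C \<subseteq> K(Z)\<close>. Hence the polynomial
  \<open>F(Z)\<close> that counts these collections \<open>T\<close> with weight \<open>t\<close> to the power \<open>|Z| - |T|\<close> is the sum of
  \<open>t\<close> to the power \<open>|C| - 1\<close> times \<open>F(Z - C)\<close>. For chordal \<open>B\<close> the generating function \<open>G(Z)\<close> of
  the \<open>B\<close>-partial permutations of support \<open>Z\<close>, weighted by \<open>1 + t\<close> to the number of descents,
  satisfies the same recursion, so \<open>F = G\<close>. The symbols \<open>x\<^sub>i\<close> range freely over the complement of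
  the union of the tubes and contribute a power of \<open>1 + t\<close>; on the side of permutations it comes from the
  decreasing tail that follows the letter \<open>n + 1\<close>.
\<close>

section \<open>The face polynomial\<close>

lemma finite_ext_element_universe:
  assumes "building_set n B"
  shows "finite (Tube ` B \<union> Design ` {1..n})"
proof -
  have "B \<subseteq> Pow {1..n}"
    using assms by (auto simp: building_set_def)
  then show ?thesis
    by (simp add: finite_subset)
qed

lemma finite_extended_nested_collection:
  assumes "building_set n B" "extended_nested_collection n B N"
  shows "finite N"
  using assms finite_subset[OF _ finite_ext_element_universe]
  by (auto simp: extended_nested_collection_def)

lemma finite_extended_nested_collections:
  assumes "building_set n B"
  shows "finite {N. extended_nested_collection n B N}"
  by (rule finite_subset[OF _ finite_Pow_iff[THEN iffD2, OF finite_ext_element_universe[OF assms]]])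
    (auto simp: extended_nested_collection_def)

text \<open>Each defining condition is universal over elements or subfamilies of \<open>N\<close>.
  This is what makes the collections a simplicial complex and permits induction one element at a
  time.\<close>

lemma extended_nested_collection_mono:
  assumes "extended_nested_collection n B N" "M \<subseteq> N"
  shows "extended_nested_collection n B M"
proof -
  have "S \<subseteq> {I. Tube I \<in> N}" if "S \<subseteq> {I. Tube I \<in> M}" for S
    using that assms(2) by blast
  then show ?thesis
    using assms unfolding extended_nested_collection_def by (meson in_mono subset_trans)
qed

text \<open>Since the face poset is a simplicial complex, a face and the one labelled by one more element
  have no face strictly between them, so the latter is a facet of the former.\<close>

lemma aff_dim_extended_nestohedron_face:
  fixes P :: "'a::euclidean_space set"
  assumes B: "building_set n B"
    and P: "polytope P" "aff_dim P = int n"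
    and bij: "bij_betw \<Phi> {N. extended_nested_collection n B N} {F. F face_of P \<and> F \<noteq> {}}"
    and anti: "\<And>M N. extended_nested_collection n B M \<Longrightarrow> extended_nested_collection n B N \<Longrightarrow>
             (\<Phi> N \<subseteq> \<Phi> M \<longleftrightarrow> M \<subseteq> N)"
    and N: "extended_nested_collection n B N"
  shows "aff_dim (\<Phi> N) = int n - int (card N)"
  using finite_extended_nested_collection[OF B N] N
proof (induction N rule: finite_induct)
  case empty
  \<comment> \<open>\<open>P\<close> is a nonempty face of itself, so it carries some label
    \<open>M\<close>. As \<open>{} \<subseteq> M\<close>, the order reversal forces
    \<open>P \<subseteq> \<Phi> {}\<close>.\<close>
  have "P \<noteq> {}"
    using P(2) by auto
  then have "P \<in> {F. F face_of P \<and> F \<noteq> {}}"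
    using P(1) by (simp add: face_of_refl polytope_imp_convex)
  then obtain M where M: "extended_nested_collection n B M" "\<Phi> M = P"
    using bij by (metis (mono_tags, lifting) bij_betw_imp_surj_on imageE mem_Collect_eq)
  have "\<Phi> {} face_of P"
    using bij empty by (auto simp: bij_betw_def)
  then have "\<Phi> {} = P"
    using anti[OF empty M(1)] M(2) face_of_imp_subset by blast
  then show ?case
    using P(2) by simp
next
  case (insert x N)
  have N: "extended_nested_collection n B N"
    using extended_nested_collection_mono[OF insert.prems] by blast
  have fN: "\<Phi> N face_of P" "\<Phi> N \<noteq> {}" and fx: "\<Phi> (insert x N) face_of P" "\<Phi> (insert x N) \<noteq> {}"
    using bij N insert.prems by (auto simp: bij_betw_def)
  have sub: "\<Phi> (insert x N) \<subseteq> \<Phi> N" and nsub: "\<not> \<Phi> N \<subseteq> \<Phi> (insert x N)"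
    using anti[OF N insert.prems] anti[OF insert.prems N] insert.hyps by auto
  have "\<Phi> (insert x N) face_of \<Phi> N"
    using face_of_face[OF fN(1)] fx(1) sub by blast
  then obtain G where G: "G facet_of \<Phi> N" "\<Phi> (insert x N) \<subseteq> G"
    using face_of_polyhedron_subset_facet[of "\<Phi> N" "\<Phi> (insert x N)"] fx(2) nsub
      polytope_imp_polyhedron[OF face_of_polytope_polytope[OF P(1) fN(1)]] by blast
  have "G face_of P" "G \<noteq> {}"
    using G(1) fN(1) face_of_trans by (auto simp: facet_of_def)
  then have "G \<in> \<Phi> ` {N. extended_nested_collection n B N}"
    using bij by (auto simp: bij_betw_def)
  then obtain K where K: "extended_nested_collection n B K" "\<Phi> K = G"
    by auto
  have "N \<subseteq> K" "K \<subseteq> insert x N"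
    using anti[OF N K(1)] anti[OF K(1) insert.prems] G(2) facet_of_imp_subset[OF G(1)]
    unfolding K(2) by blast+
  moreover have "K \<noteq> N"
    using G(1) K(2) by auto
  ultimately have "K = insert x N"
    by blast
  then have "aff_dim (\<Phi> (insert x N)) = aff_dim (\<Phi> N) - 1"
    using G(1) K(2) by (simp add: facet_of_def)
  then show ?case
    using insert.IH[OF N] insert.hyps by simp
qed

text \<open>Since a face has dimension \<open>n\<close> minus the size of its label, counting faces
  by dimension is grouping the collections by cardinality.\<close>

lemma f_polynomial_extended_nestohedron:
  fixes P :: "'a::euclidean_space set"
  assumes B: "building_set n B" and P: "extended_nestohedron n B P"
  shows "f_polynomial P = (\<Sum>N | extended_nested_collection n B N. monom 1 (n - card N))"
proof -
  let ?E = "{N. extended_nested_collection n B N}"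
  obtain \<Phi> where P: "polytope P" "aff_dim P = int n"
    and bij: "bij_betw \<Phi> ?E {F. F face_of P \<and> F \<noteq> {}}"
    and anti: "\<And>M N. extended_nested_collection n B M \<Longrightarrow> extended_nested_collection n B N \<Longrightarrow>
             (\<Phi> N \<subseteq> \<Phi> M \<longleftrightarrow> M \<subseteq> N)"
    using P unfolding extended_nestohedron_def by blast
  have dim: "aff_dim (\<Phi> N) = int n - int (card N)" if "extended_nested_collection n B N" for N
    using aff_dim_extended_nestohedron_face[OF B P bij _ that] anti by blast
  \<comment> \<open>A nonempty face has nonnegative dimension; hence the natural subtraction
    \<open>n - card N\<close> is never truncated.\<close>
  have le: "card N \<le> n" if "extended_nested_collection n B N" for N
  proof -
    have "\<Phi> N \<noteq> {}"
      using bij that by (auto simp: bij_betw_def)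
    then have "0 \<le> aff_dim (\<Phi> N)"
      using aff_dim_negative_iff[of "\<Phi> N"] by linarith
    then show ?thesis
      using dim[OF that] by simp
  qed
  have face: "face_number P i = card {N \<in> ?E. n - card N = i}" if "i \<le> n" for i
  proof -
    have "{F. F face_of P \<and> aff_dim F = int i} = \<Phi> ` {N \<in> ?E. n - card N = i}"
    proof (intro equalityI subsetI)
      fix F assume F: "F \<in> {F. F face_of P \<and> aff_dim F = int i}"
      \<comment> \<open>The empty face has dimension -1, so \<open>F\<close> is nonempty and has a
        label.\<close>
      then have "F \<in> \<Phi> ` ?E"
        using bij by (auto simp: bij_betw_def)
      then show "F \<in> \<Phi> ` {N \<in> ?E. n - card N = i}"
        using F dim by auto
    next
      fix F assume "F \<in> \<Phi> ` {N \<in> ?E. n - card N = i}"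
      then obtain N where "N \<in> ?E" "n - card N = i" "F = \<Phi> N"
        by auto
      then show "F \<in> {F. F face_of P \<and> aff_dim F = int i}"
        using bij dim[of N] le[of N] by (auto simp: bij_betw_def)
    qed
    moreover have "inj_on \<Phi> {N \<in> ?E. n - card N = i}"
      using bij by (auto simp: bij_betw_def inj_on_def)
    ultimately show ?thesis
      by (simp add: face_number_def card_image)
  qed
  have "f_polynomial P = (\<Sum>i\<le>n. monom (int (face_number P i)) i)"
    by (simp add: f_polynomial_def P(2))
  also have "\<dots> = (\<Sum>i\<le>n. \<Sum>N | N \<in> ?E \<and> n - card N = i. monom 1 (n - card N))"
    by (intro sum.cong refl) (simp add: face of_nat_monom mult_monom)
  also have "\<dots> = (\<Sum>N\<in>?E. monom 1 (n - card N))"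
    by (rule sum.group) (auto simp: finite_extended_nested_collections[OF B])
  finally show "f_polynomial P = (\<Sum>N\<in>?E. monom 1 (n - card N))" .
qed

section \<open>Sums over subsets and descents\<close>

text \<open>Nonempty subsets are sorted by their minimum \<open>b\<close>. In the recursion for
  words, \<open>b\<close> is the last letter of a decreasing run.\<close>

lemma sum_Pow_Min:
  fixes A :: "'a::linorder set"
  assumes "finite A"
  shows "(\<Sum>C\<in>Pow A - {{}}. f C) = (\<Sum>b\<in>A. \<Sum>C\<in>Pow {x \<in> A. b < x}. f (insert b C))"
proof -
  have Min: "Min (insert b C) = b" if "C \<subseteq> {x \<in> A. b < x}" for b C
  proof (rule Min_eqI)
    show "finite (insert b C)"
      using that assms finite_subset[of C A] by auto
  qed (use that in auto)
  have "(\<Sum>C\<in>Pow A - {{}}. f C) =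
      (\<Sum>(b, C)\<in>(SIGMA b:A. Pow {x \<in> A. b < x}). f (insert b C))"
  proof (rule sum.reindex_bij_witness
      [where j = "\<lambda>C. (Min C, C - {Min C})" and i = "\<lambda>(b, C). insert b C"])
    fix C assume "C \<in> Pow A - {{}}"
    then have C: "C \<subseteq> A" "C \<noteq> {}" "finite C"
      using assms finite_subset by auto
    then have "Min C \<in> C"
      by simp
    then show "(case (Min C, C - {Min C}) of (b, C) \<Rightarrow> insert b C) = C"
      and "(case (Min C, C - {Min C}) of (b, C) \<Rightarrow> f (insert b C)) = f C"
      by (auto simp: insert_absorb)
    show "(Min C, C - {Min C}) \<in> (SIGMA b:A. Pow {x \<in> A. b < x})"
      using C(1) \<open>Min C \<in> C\<close> Min_le[OF C(3)] by (auto simp: order.strict_iff_order simp del: Min_in)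
  next
    fix x assume "x \<in> (SIGMA b:A. Pow {x \<in> A. b < x})"
    then obtain b C where x: "x = (b, C)" "b \<in> A" "C \<subseteq> {x \<in> A. b < x}"
      by auto
    show "(Min (case x of (b, C) \<Rightarrow> insert b C),
        (case x of (b, C) \<Rightarrow> insert b C) - {Min (case x of (b, C) \<Rightarrow> insert b C)}) = x"
      using x Min[OF x(3)] by auto
    show "(case x of (b, C) \<Rightarrow> insert b C) \<in> Pow A - {{}}"
      using x by auto
  qed
  also have "\<dots> = (\<Sum>b\<in>A. \<Sum>C\<in>Pow {x \<in> A. b < x}. f (insert b C))"
    using assms by (intro sum.Sigma[symmetric]) auto
  finally show ?thesis .
qed

text \<open>Binomial expansion of a product of factors 1 + t: the elements outside \<open>D\<close>
  choose t. It will absorb the free choice of the symbols \<open>Design i\<close>.\<close>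

lemma sum_Pow_monom:
  assumes "finite A"
  shows "(\<Sum>D\<in>Pow A. monom 1 (card A - card D)) = ([:1, 1:] :: 'a::comm_semiring_1 poly) ^ card A"
proof -
  have "([:1, 1:] :: 'a poly) ^ card A = (\<Prod>x\<in>A. 1 + monom 1 1)"
    by (simp add: monom_altdef one_pCons)
  also have "\<dots> = (\<Sum>D\<in>Pow A. (\<Prod>x\<in>D. 1) * (\<Prod>x\<in>A - D. monom 1 1))"
    by (rule prod_add[OF assms])
  also have "\<dots> = (\<Sum>D\<in>Pow A. monom 1 (card A - card D))"
    using assms by (intro sum.cong refl) (auto simp: card_Diff_subset finite_subset monom_power)
  finally show ?thesis ..
qed

lemma pcompose_monom: "pcompose (monom 1 k) p = (p :: 'a::comm_semiring_1 poly) ^ k"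
  by (induction k) (simp_all add: monom_0 monom_Suc pcompose_pCons pcompose_1 flip: one_pCons)

section \<open>Descents of words and of their completions\<close>

definition descents :: "nat list \<Rightarrow> nat" where
  "descents w = card {i. Suc i < length w \<and> w ! Suc i < w ! i}"

lemma descents_snoc:
  "descents (w @ [a]) = descents w + (if w \<noteq> [] \<and> a < last w then 1 else 0)"
proof -
  let ?D = "{i. Suc i < length w \<and> w ! Suc i < w ! i}"
  have fin: "finite ?D"
    by (rule finite_subset[of _ "{..<length w}"]) auto
  have "{i. Suc i < length (w @ [a]) \<and> (w @ [a]) ! Suc i < (w @ [a]) ! i} =
      ?D \<union> (if w \<noteq> [] \<and> a < last w then {length w - 1} else {})"
  proof (intro equalityI subsetI)
    fix i assume i: "i \<in> {i. Suc i < length (w @ [a]) \<and> (w @ [a]) ! Suc i < (w @ [a]) ! i}"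
    show "i \<in> ?D \<union> (if w \<noteq> [] \<and> a < last w then {length w - 1} else {})"
    proof (cases "Suc i = length w")
      case True
      then have "w \<noteq> []" "i = length w - 1"
        by auto
      then show ?thesis
        using i by (auto simp: nth_append last_conv_nth)
    qed (use i in \<open>auto simp: nth_append\<close>)
  qed (auto simp: nth_append last_conv_nth split: if_splits)
  moreover have "length w - 1 \<notin> ?D"
    by auto
  ultimately show ?thesis
    using fin by (simp add: descents_def)
qed

text \<open>The letter \<open>m\<close> exceeds everything before it, so no descent ends at
  \<open>m\<close>; afterwards each letter of \<open>ds\<close> closes exactly one.\<close>

lemma descents_append_decreasing:
  assumes "sorted_wrt (>) (m # ds)" "\<forall>x\<in>set w. x < m"
  shows "descents (w @ m # ds) = descents w + length ds"
  using assms(1)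
proof (induction ds rule: rev_induct)
  case Nil
  have "\<not> m < last w" if "w \<noteq> []"
    using assms(2) that by (meson last_in_set less_asym)
  then show ?case
    by (auto simp: descents_snoc)
next
  case (snoc d ds)
  have "sorted_wrt (>) ((m # ds) @ [d])"
    using snoc.prems by simp
  then have "sorted_wrt (>) (m # ds)" "d < last (m # ds)"
    unfolding sorted_wrt_append using last_in_set[of "m # ds"] by auto
  then show ?case
    using snoc.IH descents_snoc[of "w @ m # ds" d] by simp
qed

lemma des_one_line:
  assumes "length xs = n + 1"
  shows "des n (one_line xs) = descents xs"
proof -
  have "{i \<in> {1..n}. one_line xs (i + 1) < one_line xs i} =
      Suc ` {i. Suc i < length xs \<and> xs ! Suc i < xs ! i}"
  proof (intro equalityI subsetI)
    fix i assume "i \<in> {i \<in> {1..n}. one_line xs (i + 1) < one_line xs i}"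
    then show "i \<in> Suc ` {i. Suc i < length xs \<and> xs ! Suc i < xs ! i}"
      using assms by (intro image_eqI[of _ _ "i - 1"]) (auto simp: one_line_def)
  qed (use assms in \<open>auto simp: one_line_def\<close>)
  then show ?thesis
    by (simp add: des_def descents_def card_image)
qed

text \<open>The letter \<open>n + 1\<close> never occurs in \<open>w\<close>, so it is always the
  first appended letter.\<close>

lemma completion_list:
  assumes "partial_permutation n w"
  shows "rev (sorted_list_of_set ({1..n + 1} - set w)) =
    (n + 1) # rev (sorted_list_of_set ({1..n} - set w))"
proof -
  have "sorted_list_of_set ({1..n + 1} - set w) = sorted_list_of_set ({1..n} - set w) @ [n + 1]"
  proof (rule sorted_distinct_set_unique)
    show "set (sorted_list_of_set ({1..n + 1} - set w)) =
        set (sorted_list_of_set ({1..n} - set w) @ [n + 1])"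
      using assms by (auto simp: partial_permutation_def)
  qed (auto simp: sorted_append)
  then show ?thesis
    by simp
qed

lemma des_perm_completion:
  assumes "partial_permutation n w"
  shows "des n (perm_completion n w) = descents w + (n - length w)"
proof -
  let ?ds = "rev (sorted_list_of_set ({1..n} - set w))"
  have w: "distinct w" "set w \<subseteq> {1..n}"
    using assms by (auto simp: partial_permutation_def)
  have len: "length ?ds = n - length w" "length w \<le> n"
    using w card_mono[OF _ w(2)] by (auto simp: card_Diff_subset distinct_card)
  have "sorted_wrt (>) ((n + 1) # ?ds)"
    by (auto simp: sorted_wrt_rev)
  moreover have "\<forall>x\<in>set w. x < n + 1"
    using w(2) by auto
  ultimately show ?thesis
    unfolding perm_completion_def completion_list[OF assms]
    using len by (simp add: des_one_line descents_append_decreasing)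
qed

text \<open>The word is the part of its completion in front of the letter \<open>n + 1\<close>.\<close>

lemma inj_on_perm_completion: "inj_on (perm_completion n) {w. partial_permutation n w}"
proof (rule inj_on_inverseI)
  fix w assume "w \<in> {w. partial_permutation n w}"
  then have w: "partial_permutation n w"
    by simp
  let ?xs = "w @ rev (sorted_list_of_set ({1..n + 1} - set w))"
  have d: "distinct ?xs" and s: "set ?xs = {1..n + 1}"
    using w by (auto simp: partial_permutation_def)
  have len: "length ?xs = n + 1"
    using distinct_card[OF d] unfolding s by simp
  \<comment> \<open>The upper bound is exclusive, so the positions read are 1 to
    \<open>n + 1\<close>, which undoes \<open>one_line\<close>.\<close>
  have "map (perm_completion n w) [1..<n + 2] = ?xs"
    unfolding perm_completion_def using len by (intro nth_equalityI) (auto simp: one_line_def simp del: upt_Suc)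
  moreover have "takeWhile (\<lambda>x. x \<noteq> n + 1) ?xs = w"
    unfolding completion_list[OF w] using w
    by (subst takeWhile_append2) (auto simp: partial_permutation_def)
  ultimately show "takeWhile (\<lambda>x. x \<noteq> n + 1) (map (perm_completion n w) [1..<n + 2]) = w"
    by simp
qed

section \<open>Nested collections of tubes\<close>

definition nested_tubes :: "nat set set \<Rightarrow> nat set set \<Rightarrow> bool" where
  "nested_tubes B T \<longleftrightarrow> T \<subseteq> B \<and>
     (\<forall>I\<in>T. \<forall>J\<in>T. I \<subseteq> J \<or> J \<subseteq> I \<or> I \<inter> J = {}) \<and>
     (\<forall>S\<subseteq>T. 2 \<le> card S \<longrightarrow> pairwise disjnt S \<longrightarrow> \<Union>S \<notin> B)"

lemma nested_tubes_mono: "nested_tubes B T \<Longrightarrow> S \<subseteq> T \<Longrightarrow> nested_tubes B S"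
  unfolding nested_tubes_def by (meson in_mono subset_trans)

lemma nested_tubes_empty: "nested_tubes B {}"
  by (simp add: nested_tubes_def)

text \<open>If \<open>K\<close> were missing from \<open>T\<close>, the maximal nonempty tubes
  inside \<open>K\<close> would be at least two disjoint tubes whose union \<open>K\<close> lies in
  \<open>B\<close>, which nestedness forbids.\<close>

lemma tube_mem_if_covered:
  assumes "finite T" "nested_tubes B T" "K \<in> B" "K \<noteq> {}" "K \<subseteq> \<Union>{J \<in> T. J \<subseteq> K}"
  shows "K \<in> T"
proof (rule ccontr)
  assume "K \<notin> T"
  define A where "A = {J \<in> T. J \<subseteq> K}"
  define S where "S = {J \<in> A. J \<noteq> {} \<and> (\<forall>I\<in>A. J \<subseteq> I \<longrightarrow> I = J)}"
  have "finite A" "S \<subseteq> A" "A \<subseteq> T"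
    using assms(1) by (auto simp: A_def S_def)
  have disj: "pairwise disjnt S"
    unfolding pairwise_def disjnt_def
  proof (intro ballI impI)
    fix I J assume "I \<in> S" "J \<in> S" "I \<noteq> J"
    then have "\<not> I \<subseteq> J" "\<not> J \<subseteq> I" "I \<in> T" "J \<in> T"
      using \<open>A \<subseteq> T\<close> by (auto simp: S_def)
    then show "I \<inter> J = {}"
      using assms(2) unfolding nested_tubes_def by blast
  qed
  have un: "\<Union>S = K"
  proof (intro equalityI subsetI)
    fix k assume "k \<in> K"
    then obtain J where "J \<in> A" "k \<in> J"
      using assms(5) unfolding A_def by blast
    then obtain M where "M \<in> A" "J \<subseteq> M" "\<And>I. I \<in> A \<Longrightarrow> M \<subseteq> I \<Longrightarrow> M = I"
      using finite_has_maximal2[OF \<open>finite A\<close> \<open>J \<in> A\<close>] by blast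
    with \<open>k \<in> J\<close> show "k \<in> \<Union>S"
      unfolding S_def by blast
  qed (auto simp: S_def A_def)
  have "finite S"
    using \<open>finite A\<close> \<open>S \<subseteq> A\<close> finite_subset by blast
  \<comment> \<open>No tube would make \<open>K\<close> empty, and a single one would be
    \<open>K\<close> itself, hence a member of \<open>T\<close>.\<close>
  have "card S \<noteq> 0"
    using un assms(4) \<open>finite S\<close> by auto
  moreover have "card S \<noteq> 1"
  proof
    assume "card S = 1"
    then obtain J where "S = {J}"
      by (auto simp: card_1_singleton_iff)
    then show False
      using un \<open>K \<notin> T\<close> \<open>S \<subseteq> A\<close> \<open>A \<subseteq> T\<close> by auto
  qed
  ultimately have "2 \<le> card S"
    by linarith
  moreover have "S \<subseteq> T"
    using \<open>S \<subseteq> A\<close> \<open>A \<subseteq> T\<close> by blast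
  ultimately show False
    using assms(2,3) disj un unfolding nested_tubes_def by metis
qed

section \<open>The component of the maximum\<close>

definition max_component :: "nat set set \<Rightarrow> nat set \<Rightarrow> nat set" where
  "max_component B Z = {a. same_component B Z a (Max Z)}"

lemma max_component_alt: "max_component B Z = \<Union>{J \<in> B. J \<subseteq> Z \<and> Max Z \<in> J}"
  by (auto simp: max_component_def same_component_def restriction_def)

lemma max_component_subset: "max_component B Z \<subseteq> Z"
  by (auto simp: max_component_alt)

text \<open>The common element \<open>m\<close> keeps all intersections nonempty, so members can be
  joined one after another.\<close>

lemma building_set_Union:
  assumes "building_set n B" "finite \<J>" "\<J> \<noteq> {}" "\<J> \<subseteq> B" "\<And>J. J \<in> \<J> \<Longrightarrow> m \<in> J"
  shows "\<Union>\<J> \<in> B"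
  using assms(2-5)
proof (induction \<J> rule: finite_ne_induct)
  case (insert J \<J>)
  then have "J \<in> B" "\<Union>\<J> \<in> B" "m \<in> J" "m \<in> \<Union>\<J>"
    by (auto simp: ex_in_conv)
  then have "J \<inter> \<Union>\<J> \<noteq> {}"
    by blast
  then have "J \<union> \<Union>\<J> \<in> B"
    using assms(1) \<open>J \<in> B\<close> \<open>\<Union>\<J> \<in> B\<close> unfolding building_set_def by blast
  then show ?case
    by simp
qed auto

lemma B_partial_permutation_snoc:
  "B_partial_permutation n B (w @ [a]) \<longleftrightarrow> B_partial_permutation n B w \<and>
    a \<notin> set w \<and> a \<in> {1..n} \<and> a \<in> max_component B (insert a (set w))"
proof -
  have "{1..length (w @ [a])} = insert (Suc (length w)) {1..length w}"
    by auto
  then show ?thesis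
    by (auto simp: B_partial_permutation_def partial_permutation_def max_component_def nth_append)
qed

context
  fixes n :: nat and B :: "nat set set"
  assumes B: "building_set n B"
begin

lemma building_set_finite: "finite B"
proof -
  have "B \<subseteq> Pow {1..n}"
    using B by (auto simp: building_set_def)
  then show ?thesis
    by (simp add: finite_subset)
qed

lemma building_set_nonempty: "I \<in> B \<Longrightarrow> I \<noteq> {}"
  using B by (auto simp: building_set_def)

lemma building_set_Un: "I \<in> B \<Longrightarrow> J \<in> B \<Longrightarrow> I \<inter> J \<noteq> {} \<Longrightarrow> I \<union> J \<in> B"
  using B by (auto simp: building_set_def)

lemma finite_nested_tubes: "nested_tubes B T \<Longrightarrow> finite T"
  using building_set_finite finite_subset by (auto simp: nested_tubes_def)

lemma finite_nested_tubes_Collect: "finite {T. nested_tubes B T \<and> P T}"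
  by (rule finite_subset[of _ "Pow B"]) (auto simp: nested_tubes_def building_set_finite)

lemma
  assumes "Z \<subseteq> {1..n}" "Z \<noteq> {}"
  shows Max_in_max_component: "Max Z \<in> max_component B Z"
    and max_component_mem: "max_component B Z \<in> B"
proof -
  have "Max Z \<in> Z"
    using assms finite_subset[OF assms(1)] by simp
  \<comment> \<open>The singleton makes the family of members through the maximum nonempty, as its
    union requires.\<close>
  then have *: "{Max Z} \<in> {J \<in> B. J \<subseteq> Z \<and> Max Z \<in> J}"
    using assms(1) B by (auto simp: building_set_def)
  then show "Max Z \<in> max_component B Z"
    unfolding max_component_alt by blast
  show "max_component B Z \<in> B"
    unfolding max_component_alt using * building_set_finite
    by (intro building_set_Union[OF B, where m = "Max Z"]) auto
qed

text \<open>The union of \<open>J\<close> with the component is again a member inside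
  \<open>Z\<close> through \<open>Max Z\<close>, hence already part of the component.\<close>

lemma subset_max_component:
  assumes "Z \<subseteq> {1..n}" "J \<in> B" "J \<subseteq> Z" "J \<inter> max_component B Z \<noteq> {}"
  shows "J \<subseteq> max_component B Z"
proof -
  have "Z \<noteq> {}"
    using assms(3) building_set_nonempty[OF assms(2)] by auto
  note K = max_component_mem[OF assms(1) this] Max_in_max_component[OF assms(1) this]
  have "J \<union> max_component B Z \<in> B" "J \<union> max_component B Z \<subseteq> Z"
    using building_set_Un assms K(1) max_component_subset by auto
  with K(2) show ?thesis
    unfolding max_component_alt[of B Z] by blast
qed

text \<open>Every tube meeting the component lies inside it, so the component is covered by tubes
  contained in it and \<open>tube_mem_if_covered\<close> applies.\<close>

lemma max_component_mem_nested:
  assumes Z: "Z \<subseteq> {1..n}" "Z \<noteq> {}" and T: "nested_tubes B T"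
    and cover: "max_component B Z \<subseteq> \<Union>T" and sub: "\<Union>T \<subseteq> Z"
  shows "max_component B Z \<in> T"
proof (rule tube_mem_if_covered[OF finite_nested_tubes[OF T] T max_component_mem[OF Z]])
  show "max_component B Z \<noteq> {}"
    using Max_in_max_component[OF Z] by auto
  have "J \<subseteq> max_component B Z" if "J \<in> T" "J \<inter> max_component B Z \<noteq> {}" for J
    using that T sub by (intro subset_max_component[OF Z(1)]) (auto simp: nested_tubes_def)
  with cover show "max_component B Z \<subseteq> \<Union>{J \<in> T. J \<subseteq> max_component B Z}"
    by (smt (verit, best) IntI UnionE UnionI empty_iff mem_Collect_eq subset_iff)
qed

text \<open>Every tube of \<open>T\<close> lies inside the component or is disjoint from it, so
  nestedness survives the insertion.\<close>

lemma nested_tubes_insert_max_component: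
  assumes Z: "Z \<subseteq> {1..n}" "Z \<noteq> {}" and T: "nested_tubes B T" and sub: "\<Union>T \<subseteq> Z"
  shows "nested_tubes B (insert (max_component B Z) T)"
  unfolding nested_tubes_def
proof (intro conjI)
  let ?K = "max_component B Z"
  have dich: "J \<subseteq> ?K \<or> J \<inter> ?K = {}" if "J \<in> T" for J
    using that T sub subset_max_component[OF Z(1), of J] by (auto simp: nested_tubes_def)
  show "insert ?K T \<subseteq> B"
    using T max_component_mem[OF Z] by (auto simp: nested_tubes_def)
  have "\<forall>I\<in>T. \<forall>J\<in>T. I \<subseteq> J \<or> J \<subseteq> I \<or> I \<inter> J = {}"
    using T by (simp add: nested_tubes_def)
  with dich show "\<forall>I\<in>insert ?K T. \<forall>J\<in>insert ?K T. I \<subseteq> J \<or> J \<subseteq> I \<or> I \<inter> J = {}"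
    by blast
  show "\<forall>S\<subseteq>insert ?K T. 2 \<le> card S \<longrightarrow> pairwise disjnt S \<longrightarrow> \<Union>S \<notin> B"
  proof (intro allI impI notI)
    fix S assume S: "S \<subseteq> insert ?K T" "2 \<le> card S" "pairwise disjnt S" "\<Union>S \<in> B"
    show False
    proof (cases "?K \<in> S")
      case False
      then show False
        using S T unfolding nested_tubes_def by (metis subset_insert)
    next
      case True
      have "\<not> S \<subseteq> {?K}"
        using S(2) card_mono[of "{?K}" S] by auto
      then obtain J where J: "J \<in> S" "J \<noteq> ?K"
        by blast
      \<comment> \<open>The union is a member inside \<open>Z\<close> that meets \<open>?K\<close>,
        so it cannot leave \<open>?K\<close>; yet it contains the nonempty \<open>J\<close>, which
        is disjoint from \<open>?K\<close>.\<close>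
      have "\<Union>S \<subseteq> ?K"
        using S(1) sub max_component_subset[of B Z] True Max_in_max_component[OF Z]
        by (intro subset_max_component[OF Z(1) S(4)]) auto
      moreover have "J \<inter> ?K = {}"
        using S(3) J True by (auto simp: pairwise_def disjnt_def)
      moreover have "J \<noteq> {}"
        using J S(1) T building_set_nonempty by (auto simp: nested_tubes_def)
      ultimately show False
        using J(1) by blast
    qed
  qed
qed

section \<open>Tube collections with a given union and their recursion\<close>

definition tubes_on :: "nat set \<Rightarrow> nat set set set" where
  "tubes_on Z = {T. nested_tubes B T \<and> \<Union>T = Z}"

lemma finite_tubes_on: "finite (tubes_on Z)"
  unfolding tubes_on_def by (rule finite_nested_tubes_Collect)

lemma tubes_on_empty: "tubes_on {} = {{}}"
proof -
  have "T = {}" if "nested_tubes B T" "\<Union>T = {}" for T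
  proof (rule ccontr)
    assume "T \<noteq> {}"
    then obtain I where "I \<in> T"
      by blast
    then have "I \<in> B" "I = {}"
      using that by (auto simp: nested_tubes_def)
    then show False
      using building_set_nonempty by blast
  qed
  then show ?thesis
    unfolding tubes_on_def using nested_tubes_empty by fastforce
qed

text \<open>\<open>C\<close> consists of the elements of \<open>Z\<close> that no tube other than
  the component of the maximum covers; deleting that component recovers both \<open>C\<close> and
  \<open>T\<close>.\<close>

lemma tubes_on_bij:
  assumes Z: "Z \<subseteq> {1..n}" "Z \<noteq> {}"
  shows "bij_betw (\<lambda>(C, T). insert (max_component B Z) T)
    (SIGMA C:Pow (max_component B Z) - {{}}. tubes_on (Z - C)) (tubes_on Z)"
proof -
  let ?K = "max_component B Z"
  let ?A = "SIGMA C:Pow ?K - {{}}. tubes_on (Z - C)"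
  have K: "?K \<notin> T" if "C \<subseteq> ?K" "C \<noteq> {}" "T \<in> tubes_on (Z - C)" for C T
    using that by (auto simp: tubes_on_def)
  show ?thesis
  proof (rule bij_betw_byWitness[where f' = "\<lambda>T. (Z - \<Union>(T - {?K}), T - {?K})"])
    show "\<forall>x\<in>?A. (\<lambda>T. (Z - \<Union>(T - {?K}), T - {?K})) ((\<lambda>(C, T). insert ?K T) x) = x"
    proof
      fix x assume "x \<in> ?A"
      then obtain C T where x: "x = (C, T)" and *: "C \<subseteq> ?K" "C \<noteq> {}" "T \<in> tubes_on (Z - C)"
        by auto
      then have "insert ?K T - {?K} = T" "Z - \<Union>T = C"
        using K[of C T] max_component_subset[of B Z] by (auto simp: tubes_on_def)
      then show "(\<lambda>T. (Z - \<Union>(T - {?K}), T - {?K})) ((\<lambda>(C, T). insert ?K T) x) = x"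
        by (simp add: x)
    qed
    show "\<forall>T\<in>tubes_on Z. (\<lambda>(C, T). insert ?K T) (Z - \<Union>(T - {?K}), T - {?K}) = T"
    proof
      fix T assume "T \<in> tubes_on Z"
      then have "?K \<in> T"
        using max_component_mem_nested[OF Z] max_component_subset[of B Z] by (simp add: tubes_on_def)
      then show "(\<lambda>(C, T). insert ?K T) (Z - \<Union>(T - {?K}), T - {?K}) = T"
        by auto
    qed
    show "(\<lambda>(C, T). insert ?K T) ` ?A \<subseteq> tubes_on Z"
    proof
      fix U assume "U \<in> (\<lambda>(C, T). insert ?K T) ` ?A"
      then obtain C T where *: "U = insert ?K T" "C \<subseteq> ?K" "nested_tubes B T" "\<Union>T = Z - C"
        by (auto simp: tubes_on_def)
      then have "\<Union>U = Z"
        using max_component_subset[of B Z] by auto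
      with * show "U \<in> tubes_on Z"
        using nested_tubes_insert_max_component[OF Z *(3)] by (auto simp: tubes_on_def)
    qed
    show "(\<lambda>T. (Z - \<Union>(T - {?K}), T - {?K})) ` tubes_on Z \<subseteq> ?A"
    proof (rule image_subsetI)
      fix T assume T: "T \<in> tubes_on Z"
      then have N: "nested_tubes B T" "\<Union>T = Z"
        by (auto simp: tubes_on_def)
      have N': "nested_tubes B (T - {?K})"
        using nested_tubes_mono[OF N(1)] by blast
      \<comment> \<open>Otherwise \<open>max_component_mem_nested\<close> would put
        \<open>?K\<close> into \<open>T - {?K}\<close>. This makes the recovered \<open>C\<close>
        nonempty.\<close>
      have "\<not> ?K \<subseteq> \<Union>(T - {?K})"
        using max_component_mem_nested[OF Z N'] N(2) by blast
      then have "Z - \<Union>(T - {?K}) \<noteq> {}"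
        using max_component_subset[of B Z] by blast
      moreover have "Z - \<Union>(T - {?K}) \<subseteq> ?K"
        using N(2) by auto
      moreover have "Z - (Z - \<Union>(T - {?K})) = \<Union>(T - {?K})"
        using N(2) by auto
      ultimately show "(Z - \<Union>(T - {?K}), T - {?K}) \<in> ?A"
        using N' by (auto simp: tubes_on_def)
    qed
  qed
qed

text \<open>Each removal of the component of the maximum deletes one tube and at least one element.
  The bound keeps the exponents in \<open>tube_poly\<close> free of truncation.\<close>

lemma card_tubes_on_le:
  assumes "Z \<subseteq> {1..n}" "T \<in> tubes_on Z"
  shows "card T \<le> card Z"
  using assms
proof (induction "card Z" arbitrary: Z T rule: less_induct)
  case less
  have fin: "finite Z"
    using less.prems(1) finite_subset by blast
  show ?case
  proof (cases "Z = {}")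
    case True
    then show ?thesis
      using less.prems(2) tubes_on_empty by auto
  next
    case False
    let ?K = "max_component B Z"
    have "T \<in> (\<lambda>(C, T). insert ?K T) ` (SIGMA C:Pow ?K - {{}}. tubes_on (Z - C))"
      using less.prems(2) tubes_on_bij[OF less.prems(1) False] by (simp add: bij_betw_def)
    then obtain C T' where C: "C \<subseteq> ?K" "C \<noteq> {}" "T' \<in> tubes_on (Z - C)" "T = insert ?K T'"
      by auto
    have "C \<subseteq> Z"
      using C(1) max_component_subset by blast
    then have "Z - C \<subset> Z"
      using C(2) by blast
    then have lt: "card (Z - C) < card Z"
      using fin psubset_card_mono by blast
    have "card T' \<le> card (Z - C)"
      using less.hyps[OF lt] less.prems(1) C(3) by blast
    moreover have "card T \<le> Suc (card T')"
      unfolding C(4) by (cases "finite T'") (simp_all add: card_insert_if)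
    ultimately show ?thesis
      using lt by linarith
  qed
qed

definition tube_poly :: "nat set \<Rightarrow> int poly" where
  "tube_poly Z = (\<Sum>T\<in>tubes_on Z. monom 1 (card Z - card T))"

lemma tube_poly_empty: "tube_poly {} = 1"
  by (simp add: tube_poly_def tubes_on_empty)

lemma tube_poly_rec:
  assumes Z: "Z \<subseteq> {1..n}" "Z \<noteq> {}"
  shows "tube_poly Z =
    (\<Sum>C\<in>Pow (max_component B Z) - {{}}. monom 1 (card C - 1) * tube_poly (Z - C))"
proof -
  let ?K = "max_component B Z"
  have fin: "finite Z"
    using Z(1) finite_subset by blast
  then have finK: "finite ?K"
    using max_component_subset finite_subset by blast
  have "tube_poly Z = (\<Sum>(C, T)\<in>(SIGMA C:Pow ?K - {{}}. tubes_on (Z - C)).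
      monom 1 (card Z - card (insert ?K T)))"
    unfolding tube_poly_def sum.reindex_bij_betw[OF tubes_on_bij[OF Z], symmetric]
    by (simp add: case_prod_unfold)
  also have "\<dots> = (\<Sum>C\<in>Pow ?K - {{}}. \<Sum>T\<in>tubes_on (Z - C). monom 1 (card Z - card (insert ?K T)))"
    using finK finite_tubes_on by (intro sum.Sigma[symmetric]) auto
  also have "\<dots> = (\<Sum>C\<in>Pow ?K - {{}}. monom 1 (card C - 1) * tube_poly (Z - C))"
    unfolding tube_poly_def sum_distrib_left mult_monom
  proof (intro sum.cong refl)
    fix C T assume C: "C \<in> Pow ?K - {{}}" and T: "T \<in> tubes_on (Z - C)"
    have "?K \<notin> T" "finite T"
      using C T finite_nested_tubes by (auto simp: tubes_on_def)
    moreover have CZ: "C \<subseteq> Z"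
      using C max_component_subset[of B Z] by auto
    then have "card (Z - C) = card Z - card C" "card C \<le> card Z" "card C > 0"
      using C fin by (auto simp: card_Diff_subset finite_subset card_mono card_gt_0_iff)
    moreover have "card T \<le> card (Z - C)"
      using card_tubes_on_le[OF _ T] Z(1) by blast
    \<comment> \<open>The inserted tube costs one, which is taken from the nonempty
      \<open>C\<close>; all the subtractions are exact.\<close>
    ultimately have "card Z - card (insert ?K T) = (card C - 1) + (card (Z - C) - card T)"
      by simp
    then show "monom (1::int) (card Z - card (insert ?K T)) =
        monom (1 * 1) (card C - 1 + (card (Z - C) - card T))"
      by simp
  qed
  finally show ?thesis .
qed


section \<open>Words\<close>

definition words_on :: "nat set \<Rightarrow> nat list set" where
  "words_on Z = {w. B_partial_permutation n B w \<and> set w = Z}"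

definition word_poly :: "nat set \<Rightarrow> int poly" where
  "word_poly Z = (\<Sum>w\<in>words_on Z. [:1, 1:] ^ descents w)"

text \<open>These are the words to which appending \<open>a\<close> would create a descent; the
  empty word has no last letter to compare.\<close>

definition word_poly_gt :: "nat set \<Rightarrow> nat \<Rightarrow> int poly" where
  "word_poly_gt Z a = (\<Sum>w | w \<in> words_on Z \<and> w \<noteq> [] \<and> a < last w. [:1, 1:] ^ descents w)"

lemma finite_B_partial_permutations: "finite {w. B_partial_permutation n B w}"
  by (rule finite_subset[OF _ finite_subset_distinct[of "{1..n}"]])
    (auto simp: B_partial_permutation_def partial_permutation_def)

lemma finite_words_on: "finite (words_on Z)"
  by (rule finite_subset[OF _ finite_B_partial_permutations]) (auto simp: words_on_def)

lemma words_on_empty: "words_on {} = {[]}"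
  by (auto simp: words_on_def B_partial_permutation_def partial_permutation_def)

lemma word_poly_empty: "word_poly {} = 1"
  by (simp add: word_poly_def words_on_empty descents_def)

lemma words_on_snoc:
  assumes "Z \<subseteq> {1..n}"
  shows "w @ [a] \<in> words_on Z \<longleftrightarrow> a \<in> max_component B Z \<and> w \<in> words_on (Z - {a})"
proof
  assume "w @ [a] \<in> words_on Z"
  then show "a \<in> max_component B Z \<and> w \<in> words_on (Z - {a})"
    by (auto simp: words_on_def B_partial_permutation_snoc)
next
  assume *: "a \<in> max_component B Z \<and> w \<in> words_on (Z - {a})"
  then have "a \<in> Z" "insert a Z = Z"
    using max_component_subset[of B Z] by auto
  then show "w @ [a] \<in> words_on Z"
    using * assms by (auto simp: words_on_def B_partial_permutation_snoc)
qed

text \<open>The last letter \<open>b\<close> is split off. If it creates a descent, its factor 1 + t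
  is expanded: the summand 1 completes \<open>word_poly\<close>, the summand t leaves a word with
  last letter above \<open>b\<close>.\<close>

lemma word_poly_gt_last:
  assumes "Z \<subseteq> {1..n}"
  shows "word_poly_gt Z a = (\<Sum>b | b \<in> max_component B Z \<and> a < b.
    word_poly (Z - {b}) + monom 1 1 * word_poly_gt (Z - {b}) b)"
proof -
  let ?A = "{b. b \<in> max_component B Z \<and> a < b}"
  have "finite Z"
    using assms finite_subset by blast
  then have fin: "finite ?A"
    using max_component_subset[of B Z] finite_subset by fastforce
  have "word_poly_gt Z a =
      (\<Sum>(b, w)\<in>(SIGMA b:?A. words_on (Z - {b})). [:1, 1:] ^ descents (w @ [b]))"
    unfolding word_poly_gt_def
  proof (rule sum.reindex_bij_witness[where j = "\<lambda>w. (last w, butlast w)" and i = "\<lambda>(b, w). w @ [b]"])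
    fix w assume "w \<in> {w \<in> words_on Z. w \<noteq> [] \<and> a < last w}"
    then show "(last w, butlast w) \<in> (SIGMA b:?A. words_on (Z - {b}))"
      using words_on_snoc[OF assms, of "butlast w" "last w"] by simp
  qed (auto simp: words_on_snoc[OF assms])
  also have "\<dots> = (\<Sum>b\<in>?A. \<Sum>w\<in>words_on (Z - {b}). [:1, 1:] ^ descents (w @ [b]))"
    using fin finite_words_on by (intro sum.Sigma[symmetric]) auto
  also have "\<dots> = (\<Sum>b\<in>?A. word_poly (Z - {b}) + monom 1 1 * word_poly_gt (Z - {b}) b)"
  proof (intro sum.cong refl)
    fix b
    let ?W = "words_on (Z - {b})"
    have "[:1, 1:] ^ descents (w @ [b]) = [:1, 1:] ^ descents w +
        (if w \<noteq> [] \<and> b < last w then monom 1 1 * [:1, 1:] ^ descents w else (0 :: int poly))" for w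
      by (simp add: descents_snoc monom_altdef algebra_simps)
    then have "(\<Sum>w\<in>?W. [:1, 1:] ^ descents (w @ [b])) = word_poly (Z - {b}) +
        (\<Sum>w\<in>?W. if w \<noteq> [] \<and> b < last w then monom 1 1 * [:1, 1:] ^ descents w else 0)"
      by (simp add: sum.distrib word_poly_def)
    also have "(\<Sum>w\<in>?W. if w \<noteq> [] \<and> b < last w then monom 1 1 * [:1, 1:] ^ descents w else 0) =
        monom 1 1 * word_poly_gt (Z - {b}) b"
      using finite_words_on unfolding word_poly_gt_def sum_distrib_left
      by (simp add: sum.inter_filter del: One_nat_def)
    finally show "(\<Sum>w\<in>?W. [:1, 1:] ^ descents (w @ [b])) =
        word_poly (Z - {b}) + monom 1 1 * word_poly_gt (Z - {b}) b" .
  qed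
  finally show ?thesis .
qed

text \<open>Chordality enters here: cutting the component down to its elements from \<open>x\<close>
  on leaves a member joining \<open>x\<close> to the maximum and avoiding every
  \<open>b < x\<close>.\<close>

lemma max_component_Diff:
  assumes "chordal B" "Z \<subseteq> {1..n}"
  shows "{x \<in> max_component B (Z - {b}). b < x} = {x \<in> max_component B Z. b < x}"
proof (intro equalityI subsetI)
  have fin: "finite Z"
    using assms(2) finite_subset by blast
  \<comment> \<open>An element above \<open>b\<close> shows that \<open>b\<close> is not the
    maximum, so both components refer to the same maximum.\<close>
  have Max: "Max (Z - {b}) = Max Z" "x \<le> Max Z" if "x \<in> Z" "b < x" for x
  proof -
    show "x \<le> Max Z"
      using that fin by simp
    moreover have "Max Z \<in> Z"
      using that fin by (intro Max_in) auto
    ultimately have "Max Z \<in> Z - {b}"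
      using that by auto
    then show "Max (Z - {b}) = Max Z"
      using fin by (intro Max_eqI) auto
  qed
  fix x
  {
    assume "x \<in> {x \<in> max_component B (Z - {b}). b < x}"
    then show "x \<in> {x \<in> max_component B Z. b < x}"
      using Max(1)[of x] by (fastforce simp: max_component_alt)
  next
    assume x: "x \<in> {x \<in> max_component B Z. b < x}"
    let ?J = "{j \<in> max_component B Z. x \<le> j}"
    have xZ: "x \<in> Z"
      using x max_component_subset by blast
    then have "Z \<noteq> {}"
      by auto
    then have "?J \<in> B" "Max Z \<in> ?J"
      using assms(1) x max_component_mem[OF assms(2)] Max_in_max_component[OF assms(2)] Max(2)[OF xZ]
      by (auto simp: chordal_def)
    moreover have "?J \<subseteq> Z - {b}" "x \<in> ?J"
      using x max_component_subset[of B Z] by auto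
    ultimately show "x \<in> {x \<in> max_component B (Z - {b}). b < x}"
      using x Max(1)[OF xZ] by (auto simp: max_component_alt)
  }
qed

text \<open>The set \<open>C\<close> collects the letters of a final decreasing run all of whose descents
  contribute the summand \<open>t\<close> of \<open>1 + t\<close>; chordality makes any subset of the component of the
  maximum admissible as \<open>C\<close>.\<close>

lemma word_poly_gt_rec:
  assumes "chordal B" "Z \<subseteq> {1..n}"
  shows "word_poly_gt Z a = (\<Sum>C\<in>Pow {x \<in> max_component B Z. a < x} - {{}}.
    monom 1 (card C - 1) * word_poly (Z - C))"
  using assms(2)
proof (induction "card Z" arbitrary: Z a rule: less_induct)
  case less
  let ?K = "max_component B Z"
  let ?f = "\<lambda>C. monom 1 (card C - 1) * word_poly (Z - C)"
  have "finite Z"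
    using less.prems finite_subset by blast
  then have fin: "finite {x \<in> ?K. P x}" for P
    using max_component_subset[of B Z] finite_subset[of "{x \<in> ?K. P x}" Z] by auto
  have step: "word_poly (Z - {b}) + monom 1 1 * word_poly_gt (Z - {b}) b =
      (\<Sum>C\<in>Pow {x \<in> ?K. b < x}. ?f (insert b C))" if "b \<in> ?K" for b
  proof -
    let ?P = "Pow {x \<in> ?K. b < x}"
    \<comment> \<open>The induction hypothesis is used with bound \<open>b\<close>; by
      \<open>max_component_Diff\<close> its subsets range over the part of the old component above
      \<open>b\<close>.\<close>
    have "card (Z - {b}) < card Z"
      using that max_component_subset \<open>finite Z\<close> by (meson card_Diff1_less subsetD)
    then have "word_poly_gt (Z - {b}) b =
        (\<Sum>C\<in>?P - {{}}. monom 1 (card C - 1) * word_poly (Z - {b} - C))"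
      using less.hyps[of "Z - {b}" b] less.prems max_component_Diff[OF assms(1) less.prems] by auto
    then have "monom 1 1 * word_poly_gt (Z - {b}) b =
        (\<Sum>C\<in>?P - {{}}. monom 1 1 * (monom 1 (card C - 1) * word_poly (Z - {b} - C)))"
      by (simp add: sum_distrib_left)
    also have "\<dots> = (\<Sum>C\<in>?P - {{}}. ?f (insert b C))"
    proof (intro sum.cong refl)
      fix C assume C: "C \<in> ?P - {{}}"
      then have "finite C" "b \<notin> C" "C \<noteq> {}"
        using finite_subset[OF _ fin[of "\<lambda>x. b < x"]] by auto
      then have "card C = Suc (card C - 1)" "card (insert b C) = Suc (card C)"
        by (auto simp: card_gt_0_iff)
      moreover have "Z - {b} - C = Z - insert b C"
        by auto
      ultimately show "monom 1 1 * (monom 1 (card C - 1) * word_poly (Z - {b} - C)) = ?f (insert b C)"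
        by (simp add: mult_monom flip: mult.assoc)
    qed
    \<comment> \<open>The first summand is the missing case in which the run consists of
      \<open>b\<close> alone.\<close>
    finally have "word_poly (Z - {b}) + monom 1 1 * word_poly_gt (Z - {b}) b =
        ?f (insert b {}) + (\<Sum>C\<in>?P - {{}}. ?f (insert b C))"
      by simp
    also have "\<dots> = (\<Sum>C\<in>?P. ?f (insert b C))"
      using fin by (intro sum.remove[symmetric]) auto
    finally show ?thesis .
  qed
  have "word_poly_gt Z a =
      (\<Sum>b | b \<in> ?K \<and> a < b. \<Sum>C\<in>Pow {x \<in> ?K. b < x}. ?f (insert b C))"
    unfolding word_poly_gt_last[OF less.prems] by (intro sum.cong refl step) auto
  \<comment> \<open>For \<open>a < b\<close> the extra bound changes nothing; it brings the sum into
    the form of \<open>sum_Pow_Min\<close>.\<close>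
  also have "\<dots> = (\<Sum>b | b \<in> ?K \<and> a < b.
      \<Sum>C\<in>Pow {x \<in> {x \<in> ?K. a < x}. b < x}. ?f (insert b C))"
    by (intro sum.cong refl arg_cong[of _ _ Pow]) auto
  also have "\<dots> = (\<Sum>C\<in>Pow {x \<in> ?K. a < x} - {{}}. ?f C)"
    by (rule sum_Pow_Min[OF fin, symmetric])
  finally show ?case .
qed

lemma word_poly_rec:
  assumes "chordal B" "Z \<subseteq> {1..n}" "Z \<noteq> {}"
  shows "word_poly Z =
    (\<Sum>C\<in>Pow (max_component B Z) - {{}}. monom 1 (card C - 1) * word_poly (Z - C))"
proof -
  \<comment> \<open>All letters are at least 1, so the bound 0 admits every word with nonempty
    support.\<close>
  have "w \<noteq> [] \<and> 0 < last w" if "w \<in> words_on Z" for w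
  proof -
    have "w \<noteq> []" "set w \<subseteq> {1..n}"
      using that assms(2,3) by (auto simp: words_on_def)
    then show ?thesis
      using last_in_set[of w] by fastforce
  qed
  then have "{w \<in> words_on Z. w \<noteq> [] \<and> 0 < last w} = words_on Z"
    by blast
  then have "word_poly Z = word_poly_gt Z 0"
    by (simp add: word_poly_def word_poly_gt_def)
  moreover have "{x \<in> max_component B Z. 0 < x} = max_component B Z"
    using assms(2) max_component_subset[of B Z] by fastforce
  ultimately show ?thesis
    using word_poly_gt_rec[OF assms(1,2), of 0] by simp
qed

lemma tube_poly_eq_word_poly:
  assumes "chordal B" "Z \<subseteq> {1..n}"
  shows "tube_poly Z = word_poly Z"
  using assms(2)
proof (induction "card Z" arbitrary: Z rule: less_induct)
  case less
  show ?case
  proof (cases "Z = {}")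
    case True
    then show ?thesis
      by (simp add: tube_poly_empty word_poly_empty)
  next
    case False
    have "tube_poly (Z - C) = word_poly (Z - C)" if "C \<in> Pow (max_component B Z) - {{}}" for C
    proof (rule less.hyps)
      have "Z - C \<subset> Z"
        using that max_component_subset[of B Z] by blast
      then show "card (Z - C) < card Z"
        using less.prems finite_subset psubset_card_mono by blast
    qed (use less.prems in auto)
    then show ?thesis
      unfolding tube_poly_rec[OF less.prems False] word_poly_rec[OF assms(1) less.prems False]
      by (intro sum.cong refl) simp
  qed
qed

section \<open>Summation over supports\<close>

lemma extended_nested_collection_iff:
  "extended_nested_collection n B N \<longleftrightarrow> nested_tubes B {I. Tube I \<in> N} \<and>
    {i. Design i \<in> N} \<subseteq> {1..n} - \<Union>{I. Tube I \<in> N}"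
proof -
  have univ: "N \<subseteq> Tube ` B \<union> Design ` {1..n} \<longleftrightarrow>
      {I. Tube I \<in> N} \<subseteq> B \<and> {i. Design i \<in> N} \<subseteq> {1..n}"
  proof (intro iffI subsetI; (elim conjE)?)
    fix x assume "{I. Tube I \<in> N} \<subseteq> B" "{i. Design i \<in> N} \<subseteq> {1..n}" "x \<in> N"
    then show "x \<in> Tube ` B \<union> Design ` {1..n}"
      by (cases x) auto
  qed auto
  have design: "{i. Design i \<in> N} \<subseteq> {1..n} - \<Union>{I. Tube I \<in> N} \<longleftrightarrow>
      {i. Design i \<in> N} \<subseteq> {1..n} \<and> (\<forall>i I. Design i \<in> N \<longrightarrow> Tube I \<in> N \<longrightarrow> i \<notin> I)"
    by blast
  have tube: "(\<forall>I\<in>{I. Tube I \<in> N}. \<forall>J\<in>{I. Tube I \<in> N}. Q I J) \<longleftrightarrow>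
      (\<forall>I J. Tube I \<in> N \<longrightarrow> Tube J \<in> N \<longrightarrow> Q I J)" for Q
    by blast
  show ?thesis
    unfolding extended_nested_collection_def nested_tubes_def univ design tube by argo
qed

lemma extended_nested_collections_bij:
  "bij_betw (\<lambda>(T, D). Tube ` T \<union> Design ` D)
    (SIGMA T:{T. nested_tubes B T}. Pow ({1..n} - \<Union>T)) {N. extended_nested_collection n B N}"
proof (rule bij_betw_byWitness[where f' = "\<lambda>N. ({I. Tube I \<in> N}, {i. Design i \<in> N})"])
  let ?A = "SIGMA T:{T. nested_tubes B T}. Pow ({1..n} - \<Union>T)"
  show "\<forall>x\<in>?A. (\<lambda>N. ({I. Tube I \<in> N}, {i. Design i \<in> N})) ((\<lambda>(T, D). Tube ` T \<union> Design ` D) x) = x"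
    by (clarsimp simp: image_iff)
  have decomp: "Tube ` {I. Tube I \<in> N} \<union> Design ` {i. Design i \<in> N} = N" for N
  proof (intro equalityI subsetI)
    fix x assume "x \<in> N"
    then show "x \<in> Tube ` {I. Tube I \<in> N} \<union> Design ` {i. Design i \<in> N}"
      by (cases x) auto
  qed auto
  then show "\<forall>N\<in>{N. extended_nested_collection n B N}.
      (\<lambda>(T, D). Tube ` T \<union> Design ` D) ({I. Tube I \<in> N}, {i. Design i \<in> N}) = N"
    by simp
  show "(\<lambda>(T, D). Tube ` T \<union> Design ` D) ` ?A \<subseteq> {N. extended_nested_collection n B N}"
  proof
    fix N assume "N \<in> (\<lambda>(T, D). Tube ` T \<union> Design ` D) ` ?A"
    then obtain T D where N: "N = Tube ` T \<union> Design ` D" "nested_tubes B T" "D \<subseteq> {1..n} - \<Union>T"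
      by auto
    then have *: "\<And>I. Tube I \<in> N \<longleftrightarrow> I \<in> T" "\<And>i. Design i \<in> N \<longleftrightarrow> i \<in> D"
      by (simp_all add: image_iff)
    with N(2,3) show "N \<in> {N. extended_nested_collection n B N}"
      by (simp add: extended_nested_collection_iff)
  qed
  show "(\<lambda>N. ({I. Tube I \<in> N}, {i. Design i \<in> N})) ` {N. extended_nested_collection n B N} \<subseteq> ?A"
    by (simp add: image_subset_iff extended_nested_collection_iff)
qed

text \<open>For tubes with union \<open>Z\<close> the design symbols form any subset of the
  complement of \<open>Z\<close>, which sums to \<open>[:1, 1:] ^ (n - card Z)\<close>.\<close>

lemma sum_extended_nested_collections:
  "(\<Sum>N | extended_nested_collection n B N. monom (1 :: int) (n - card N)) =
    (\<Sum>Z\<in>Pow {1..n}. [:1, 1:] ^ (n - card Z) * tube_poly Z)"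
proof -
  have sub: "\<Union>T \<subseteq> {1..n}" if "nested_tubes B T" for T
    using that B by (auto simp: nested_tubes_def building_set_def)
  have "(\<Sum>N | extended_nested_collection n B N. monom (1 :: int) (n - card N)) =
      (\<Sum>(T, D)\<in>(SIGMA T:{T. nested_tubes B T}. Pow ({1..n} - \<Union>T)).
        monom 1 (n - card (Tube ` T \<union> Design ` D)))"
    unfolding sum.reindex_bij_betw[OF extended_nested_collections_bij, symmetric]
    by (simp add: case_prod_unfold)
  also have "\<dots> = (\<Sum>T | nested_tubes B T. \<Sum>D\<in>Pow ({1..n} - \<Union>T).
      monom 1 (n - card (Tube ` T \<union> Design ` D)))"
    using finite_nested_tubes_Collect[of "\<lambda>_. True"] by (intro sum.Sigma[symmetric]) auto
  also have "\<dots> = (\<Sum>T | nested_tubes B T.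
      [:1, 1:] ^ (n - card (\<Union>T)) * monom 1 (card (\<Union>T) - card T))"
  proof (intro sum.cong refl)
    fix T assume "T \<in> {T. nested_tubes B T}"
    then have T: "nested_tubes B T"
      by simp
    let ?A = "{1..n} - \<Union>T"
    have cA: "card ?A = n - card (\<Union>T)" "card (\<Union>T) \<le> n"
      using sub[OF T] card_mono[OF _ sub[OF T]] finite_subset[OF sub[OF T]]
      by (auto simp: card_Diff_subset)
    have "monom (1 :: int) (n - card (Tube ` T \<union> Design ` D)) =
        monom 1 (card ?A - card D) * monom 1 (card (\<Union>T) - card T)" if "D \<in> Pow ?A" for D
    proof -
      have "finite D"
        using that finite_subset by blast
      then have "card (Tube ` T \<union> Design ` D) = card T + card D"
        using finite_nested_tubes[OF T]
        by (subst card_Un_disjoint) (auto simp: card_image inj_on_def)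
      moreover have "card D \<le> card ?A"
        using that by (intro card_mono) auto
      moreover have "card T \<le> card (\<Union>T)"
        using card_tubes_on_le[OF sub[OF T]] T by (simp add: tubes_on_def)
      ultimately have "n - card (Tube ` T \<union> Design ` D) = (card ?A - card D) + (card (\<Union>T) - card T)"
        using cA by linarith
      then show ?thesis
        by (simp add: mult_monom)
    qed
    then have "(\<Sum>D\<in>Pow ?A. monom (1 :: int) (n - card (Tube ` T \<union> Design ` D))) =
        (\<Sum>D\<in>Pow ?A. monom 1 (card ?A - card D)) * monom 1 (card (\<Union>T) - card T)"
      unfolding sum_distrib_right by (intro sum.cong refl) auto
    then show "(\<Sum>D\<in>Pow ?A. monom (1 :: int) (n - card (Tube ` T \<union> Design ` D))) =
        [:1, 1:] ^ (n - card (\<Union>T)) * monom 1 (card (\<Union>T) - card T)"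
      by (simp only: cA(1) sum_Pow_monom[of ?A, OF finite_Diff[OF finite_atLeastAtMost], unfolded cA(1)])
  qed
  also have "\<dots> = (\<Sum>Z\<in>Pow {1..n}. \<Sum>T | T \<in> {T. nested_tubes B T} \<and> \<Union>T = Z.
      [:1, 1:] ^ (n - card (\<Union>T)) * monom 1 (card (\<Union>T) - card T))"
    using sub finite_nested_tubes_Collect[of "\<lambda>_. True"] by (intro sum.group[symmetric]) auto
  also have "\<dots> = (\<Sum>Z\<in>Pow {1..n}. [:1, 1:] ^ (n - card Z) * tube_poly Z)"
    unfolding tube_poly_def tubes_on_def sum_distrib_left by (intro sum.cong refl) auto
  finally show ?thesis .
qed

text \<open>Letters are distinct, so \<open>length w\<close> is the size of the support, and the
  descents of the tail depend on the support alone.\<close>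

lemma sum_B_partial_permutations:
  "(\<Sum>w | B_partial_permutation n B w. [:1, 1 :: int:] ^ (descents w + (n - length w))) =
    (\<Sum>Z\<in>Pow {1..n}. [:1, 1:] ^ (n - card Z) * word_poly Z)"
proof -
  let ?W = "{w. B_partial_permutation n B w}"
  have "(\<Sum>w\<in>?W. [:1, 1 :: int:] ^ (descents w + (n - length w))) =
      (\<Sum>Z\<in>Pow {1..n}. \<Sum>w | w \<in> ?W \<and> set w = Z. [:1, 1:] ^ (descents w + (n - length w)))"
    using finite_B_partial_permutations
    by (intro sum.group[symmetric]) (auto simp: B_partial_permutation_def partial_permutation_def)
  also have "\<dots> = (\<Sum>Z\<in>Pow {1..n}. [:1, 1:] ^ (n - card Z) * word_poly Z)"
    unfolding word_poly_def words_on_def sum_distrib_left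
    by (intro sum.cong refl)
      (auto simp: B_partial_permutation_def partial_permutation_def distinct_card power_add)
  finally show ?thesis .
qed

end

theorem theorem6p11:
  fixes n :: nat and B :: "nat set set" and P :: "'a::euclidean_space set"
  assumes "building_set n B"
    and "chordal B"
    and "extended_nestohedron n B P"
  shows "h_polynomial P = (\<Sum>w\<in>extended_B_permutations n B. monom 1 (des n w))"
proof -
  let ?W = "{w. B_partial_permutation n B w}"
  have W: "partial_permutation n w" if "w \<in> ?W" for w
    using that by (simp add: B_partial_permutation_def)
  \<comment> \<open>Substituting t + 1 determines a polynomial, so it suffices to identify the
    result with \<open>f_polynomial P\<close>.\<close>
  have "pcompose (\<Sum>w\<in>extended_B_permutations n B. monom 1 (des n w)) [:1, 1 :: int:] =
      (\<Sum>w\<in>extended_B_permutations n B. [:1, 1:] ^ des n w)"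
    by (simp add: pcompose_sum pcompose_monom)
  \<comment> \<open>Distinct words have distinct completions, so the set of permutations may be
    summed over words.\<close>
  also have "\<dots> = (\<Sum>w\<in>?W. [:1, 1:] ^ des n (perm_completion n w))"
    unfolding extended_B_permutations_def
    using inj_on_subset[OF inj_on_perm_completion[of n], of ?W] W
    by (subst sum.reindex) (auto simp: subset_iff)
  also have "\<dots> = (\<Sum>w\<in>?W. [:1, 1:] ^ (descents w + (n - length w)))"
    using W by (intro sum.cong refl) (simp add: des_perm_completion)
  also have "\<dots> = (\<Sum>Z\<in>Pow {1..n}. [:1, 1:] ^ (n - card Z) * word_poly n B Z)"
    by (rule sum_B_partial_permutations[OF assms(1)])
  also have "\<dots> = (\<Sum>Z\<in>Pow {1..n}. [:1, 1:] ^ (n - card Z) * tube_poly B Z)"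
    using tube_poly_eq_word_poly[OF assms(1,2)] by (intro sum.cong refl) auto
  also have "\<dots> = f_polynomial P"
    unfolding f_polynomial_extended_nestohedron[OF assms(1,3)]
    by (rule sum_extended_nested_collections[OF assms(1), symmetric])
  finally show ?thesis
    using h_polynomial_unique[of P] pcompose_h_polynomial[of P] by metis
qed

end
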